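(* For every integer $k\ge3$, every satellite graph $S_{2k+1}$ satisfies the ACK property: there exists a nonzero $\{0,1\}$-vector in the row space over $\mathbb{R}$ of the adjacency matrix of $S_{2k+1}$ that is not one of its rows.
   Context: For an integer $k\ge3$, a satellite graph $S_{2k+1}$ is a simple graph on $2k+1$ vertices whose vertex set is partitioned into a single vertex $v_{\mathrm{dom}}$, a set $V_4=\{u_1,\dots,u_k\}$ and a set $V_2=\{w_1,\dots,w_k\}$, with edges: $v_{\mathrm{dom}}$ is adjacent to every other vertex; each vertex of $V_4$ is adjacent to exactly two vertices of $V_4$ and exactly one vertex of $V_2$; each vertex of $V_2$ is adjacent to exactly one vertex of $V_4$ (and to $v_{\mathrm{dom}}$); no other edges. *)

theory Defs
  imports "HOL-Analysis.Analysis"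
begin

text \<open>
  A finite simple graph is given by its adjacency relation; the vertex set is the whole
  (finite) type, so that the vertices index the adjacency matrix.
\<close>

definition simple_graph :: "('v::finite \<Rightarrow> 'v \<Rightarrow> bool) \<Rightarrow> bool" where
  "simple_graph E \<longleftrightarrow> irreflp E \<and> symp E"

definition adjacency_matrix :: "('v::finite \<Rightarrow> 'v \<Rightarrow> bool) \<Rightarrow> real ^ 'v ^ 'v" where
  "adjacency_matrix E = (\<chi> i j. if E i j then 1 else 0)"

definition row_space :: "real ^ 'n ^ 'm \<Rightarrow> (real ^ 'n) set" where
  "row_space A = span (rows A)"

definition ack_property :: "('v::finite \<Rightarrow> 'v \<Rightarrow> bool) \<Rightarrow> bool" where
  "ack_property E \<longleftrightarrow>
     (\<exists>x. x \<in> row_space (adjacency_matrix E) \<and> x \<noteq> 0 \<and> (\<forall>i. x $ i \<in> {0, 1}) \<and>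
          x \<notin> rows (adjacency_matrix E))"

text \<open>
  The graph need not be unique: the two-regular graph induced on \<open>V4\<close> may be any disjoint
  union of cycles. As \<open>vdom\<close> is adjacent to everything and the pairs inside \<open>V4\<close> and between
  \<open>V4\<close> and \<open>V2\<close> are governed by the cardinality conditions, the clause ``no other edges''
  amounts to the absence of edges inside \<open>V2\<close>.
\<close>

definition satellite_graph :: "nat \<Rightarrow> ('v::finite \<Rightarrow> 'v \<Rightarrow> bool) \<Rightarrow> bool" where
  "satellite_graph k E \<longleftrightarrow>
     simple_graph E \<and> CARD('v) = 2 * k + 1 \<and>
     (\<exists>vdom V4 V2.
        {vdom} \<union> V4 \<union> V2 = UNIV \<and> vdom \<notin> V4 \<and> vdom \<notin> V2 \<and> V4 \<inter> V2 = {} \<and>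
        card V4 = k \<and> card V2 = k \<and>
        (\<forall>v. v \<noteq> vdom \<longrightarrow> E vdom v) \<and>
        (\<forall>u\<in>V4. card {v\<in>V4. E u v} = 2 \<and> card {w\<in>V2. E u w} = 1) \<and>
        (\<forall>w\<in>V2. card {u\<in>V4. E w u} = 1) \<and>
        (\<forall>w\<in>V2. \<forall>w'\<in>V2. \<not> E w w'))"

end

theory Submission
  imports Defs
begin

text \<open>
  Let \<open>u\<close> in \<open>V4\<close> have the neighbours \<open>p, q\<close> in \<open>V4\<close>, and let \<open>u', p', q'\<close> in \<open>V2\<close> be attached
  to \<open>u, p, q\<close>. The rows of \<open>u, u', p', q'\<close> are the indicators of \<open>{vdom, p, q, u'}\<close>,
  \<open>{vdom, u}\<close>, \<open>{vdom, p}\<close>, \<open>{vdom, q}\<close>, so adding the first two and subtracting the last two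
  gives the indicator of \<open>{u, u'}\<close>. It is no row: it vanishes at \<open>vdom\<close>, as only the row
  of \<open>vdom\<close> does, but that row is \<open>1\<close> at \<open>p\<close>.
\<close>

lemma row_adjacency_matrix_nth:
  "row i (adjacency_matrix E) $ j = (if E i j then 1 else 0)"
  by (simp add: row_def adjacency_matrix_def)

lemma row_in_row_space: "row i A \<in> row_space A"
  by (auto simp: row_space_def rows_def intro: span_base)

theorem theorem4p4:
  fixes k :: nat and E :: "'v::finite \<Rightarrow> 'v \<Rightarrow> bool"
  assumes "k \<ge> 3" and "satellite_graph k E"
  shows "ack_property E"
proof -
  from assms(2) obtain d V4 V2 where irr: "irreflp E" and sym: "symp E"
    and cover: "{d} \<union> V4 \<union> V2 = UNIV" and d4: "d \<notin> V4" and d2: "d \<notin> V2"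
    and disj: "V4 \<inter> V2 = {}" and card4: "card V4 = k"
    and dom_all: "\<forall>v. v \<noteq> d \<longrightarrow> E d v"
    and deg4: "\<forall>u\<in>V4. card {v\<in>V4. E u v} = 2 \<and> card {w\<in>V2. E u w} = 1"
    and deg2: "\<forall>w\<in>V2. card {u\<in>V4. E w u} = 1"
    and indep_all: "\<forall>w\<in>V2. \<forall>w'\<in>V2. \<not> E w w'"
    unfolding satellite_graph_def simple_graph_def by (elim exE conjE) (rule that; assumption)
  note dom = dom_all[rule_format] and indep = indep_all[rule_format]
    and deg44 = bspec[OF deg4, THEN conjunct1] and deg42 = bspec[OF deg4, THEN conjunct2]
    and deg24 = bspec[OF deg2]
  have dom': "E v d" if "v \<noteq> d" for v
    using dom[OF that] sym by (rule sympD[rotated])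
  \<comment> \<open>By symmetry \<open>v\<close> is the single neighbour of \<open>w\<close> in
    \<open>V4\<close>, and \<open>V2\<close> is independent, so only \<open>d\<close> can be added.
    The singleton equation is kept because it later supplies the \<open>V2\<close> part of the row
    of \<open>u\<close>.\<close>
  have satellite: "\<exists>w\<in>V2. {x\<in>V2. E v x} = {w} \<and> (\<forall>j. E w j \<longleftrightarrow> j = d \<or> j = v)"
    if v: "v \<in> V4" for v
  proof -
    obtain w where w: "{x\<in>V2. E v x} = {w}"
      using deg42[OF v] by (auto simp: card_1_singleton_iff)
    then have wV: "w \<in> V2" and "E v w" by auto
    then have "E w v" using sym by (blast dest: sympD)
    moreover obtain z where "{x\<in>V4. E w x} = {z}"
      using deg24[OF wV] by (auto simp: card_1_singleton_iff)
    ultimately have nbr: "{x\<in>V4. E w x} = {v}" using v by auto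
    have "E w d" using wV d2 by (intro dom') auto
    have "E w j \<longleftrightarrow> j = d \<or> j = v" for j
    proof -
      have "j = d \<or> j \<in> V4 \<or> j \<in> V2" using cover by auto
      then show ?thesis using nbr \<open>E w d\<close> \<open>E w v\<close> indep[OF wV, of j] by blast
    qed
    with w wV show ?thesis by blast
  qed
  obtain u where u: "u \<in> V4" using card4 assms(1) by fastforce
  obtain p q where pq: "{v\<in>V4. E u v} = {p, q}" "p \<noteq> q"
    using deg44[OF u] by (auto simp: card_2_iff)
  then have p: "p \<in> V4" and q: "q \<in> V4" and "E u p" "E u q" by auto
  \<comment> \<open>As there are no loops, subtracting the rows of \<open>p'\<close> and
    \<open>q'\<close> leaves the entry at \<open>u\<close> untouched.\<close>
  then have "u \<noteq> p" "u \<noteq> q" using irr by (auto dest: irreflpD)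
  obtain u' where u': "u' \<in> V2" "{x\<in>V2. E u x} = {u'}"
    and row_u': "\<And>j. E u' j \<longleftrightarrow> j = d \<or> j = u"
    using satellite[OF u] by blast
  obtain p' where row_p': "\<And>j. E p' j \<longleftrightarrow> j = d \<or> j = p"
    using satellite[OF p] by blast
  obtain q' where row_q': "\<And>j. E q' j \<longleftrightarrow> j = d \<or> j = q"
    using satellite[OF q] by blast
  have row_u: "E u j \<longleftrightarrow> j = d \<or> j = p \<or> j = q \<or> j = u'" for j
  proof -
    have "j = d \<or> j \<in> V4 \<or> j \<in> V2" using cover by auto
    moreover have "E u d" using u d4 by (intro dom') auto
    ultimately show ?thesis using pq(1) u'(2) by blast
  qed
  have "u' \<noteq> d" "u' \<noteq> u" "u' \<noteq> p" "u' \<noteq> q" "u \<noteq> d" "p \<noteq> d" "q \<noteq> d"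
    using u'(1) d2 d4 u p q disj by auto
  note distinct = this \<open>u \<noteq> p\<close> \<open>u \<noteq> q\<close> \<open>p \<noteq> q\<close>
  let ?A = "adjacency_matrix E"
  define x where "x = row u ?A + row u' ?A - row p' ?A - row q' ?A"
  \<comment> \<open>The entry at \<open>d\<close> is 1 + 1 - 1 - 1. At \<open>p\<close> and
    \<open>q\<close> the row of \<open>u\<close> cancels against those of \<open>p'\<close> and
    \<open>q'\<close>. The ones at \<open>u\<close> and \<open>u'\<close> come from the rows of
    \<open>u'\<close> and \<open>u\<close> respectively.\<close>
  have x_nth: "x $ j = (if j = u \<or> j = u' then 1 else 0)" for j
    using distinct by (auto simp: x_def row_adjacency_matrix_nth row_u row_u' row_p' row_q')
  have "x \<in> row_space ?A"
    unfolding x_def using row_in_row_space[of _ ?A] unfolding row_space_def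
    by (intro span_add span_diff)
  moreover have "x \<noteq> 0" using x_nth[of u] by auto
  moreover have "x \<notin> rows ?A"
  proof
    assume "x \<in> rows ?A"
    then obtain i where i: "x = row i ?A" by (auto simp: rows_def)
    have "x $ d = 0" "x $ p = 0" using distinct by (auto simp: x_nth)
    then have "\<not> E i d" "\<not> E i p"
      by (auto simp: i row_adjacency_matrix_nth split: if_splits)
    \<comment> \<open>Every vertex other than \<open>d\<close> is adjacent to \<open>d\<close>, so
      its row has a 1 there.\<close>
    then have "i = d" using dom'[of i] by blast
    then show False using \<open>\<not> E i p\<close> dom \<open>p \<noteq> d\<close> by blast
  qed
  ultimately show ?thesis
    unfolding ack_property_def using x_nth by (intro exI[of _ x]) auto
qed

end
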